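(* Let $(S_O,P_O)$ be a deductive source with irredundant core $A=\mathrm{Atom}(S_O)$ and reconstruction alphabet $\hat S_O$. Assume: (1) $A\neq\varnothing$; (2) either ($P_A=0$ and $\hat S_O\cap\mathrm{Cn}(S_O)\neq\varnothing$) or ($P_A>0$ and $R_{\mathrm{Cn}}(a)\neq\varnothing$ for every $a\in A$); (3) (pairwise realisability) for every nonempty $W\subseteq A$, if $R_{\mathrm{Cn}}(a)\cap R_{\mathrm{Cn}}(a')\neq\emptyset$ for all $a\neq a'$ in $W$, then $\bigcap_{a\in W}R_{\mathrm{Cn}}(a)\neq\emptyset$. Then $$R_{\mathrm{sem}}(0;d_{\mathrm{Cn}},P_O)=P_A\,H_{G_{\mathrm{inc}}}(\pi_A),$$ with the convention that the right-hand side is $0$ when $P_A=0$.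
   Context: Setting. $\mathbb{S}_O$ is a finite set of statements with a fixed proof system with decidable derivability; $\mathrm{Cn}(\Gamma)\subseteq\mathbb{S}_O$ denotes the set of statements derivable from $\Gamma\subseteq\mathbb{S}_O$. $\mathrm{Cn}$ is reflexive ($\Gamma\subseteq\mathrm{Cn}(\Gamma)$), monotone ($\Gamma\subseteq\Gamma'\Rightarrow\mathrm{Cn}(\Gamma)\subseteq\mathrm{Cn}(\Gamma')$) and idempotent. $S_O\subseteq\mathbb{S}_O$ is a finite knowledge base with a fixed linear (canonical) order, $\hat S_O\subseteq\mathbb{S}_O$ is a nonempty finite reconstruction alphabet, and a deductive source is a pair $(S_O,P_O)$ with $P_O$ a probability distribution on $S_O$. Core. $\mathrm{Atom}(S_O)$ is the output of the deletion procedure: start with $B=S_O$; scan the elements $s$ of $S_O$ in the canonical order; whenever the scanned $s$ satisfies $s\in\mathrm{Cn}(B\setminus\{s\})$ for the current $B$, remove $s$ from $B$; the final $B$ is $\mathrm{Atom}(S_O)$. Put $A=\mathrm{Atom}(S_O)$, $P_A=P_O(A)$ and, if $P_A>0$, $\pi_A(a)=P_O(a)/P_A$ for $a\in A$. Closure distortion. For $s\in S_O$, $\hat s\in\mathbb{S}_O$, let $C_s=\mathrm{Cn}(S_O)$ and $C_{\hat s}=\mathrm{Cn}((S_O\setminus\{s\})\cup\{\hat s\})$; then $d_{\mathrm{Cn}}(s,\hat s)=d_{\mathrm{Cn}}(s,\hat s\mid S_O)=1-|C_s\cap C_{\hat s}|/|C_s\cup C_{\hat s}|$, with $0/0$ giving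 distortion $0$. For $s\in S_O$, $R_{\mathrm{Cn}}(s)=\{\hat s\in\hat S_O: d_{\mathrm{Cn}}(s,\hat s\mid S_O)=0\}$. Rate–distortion function. $R_{\mathrm{sem}}(D;d_{\mathrm{Cn}},P_O)$ is the minimum of the mutual information $I(\mathsf S_o;\hat{\mathsf S}_o)$ over all test channels $P_{\hat S\mid S}$ from $S_O$ to $\hat S_O$ with $\mathbb{E}[d_{\mathrm{Cn}}(\mathsf S_o,\hat{\mathsf S}_o)]\le D$, where $\mathsf S_o\sim P_O$ and $\hat{\mathsf S}_o\sim P_{\hat S\mid S}(\cdot\mid\mathsf S_o)$ (value $+\infty$ if no such channel exists). Graph entropy. The core incompatibility graph $G_{\mathrm{inc}}$ has vertex set $A$, and distinct $a,a'\in A$ are adjacent iff $R_{\mathrm{Cn}}(a)\cap R_{\mathrm{Cn}}(a')=\emptyset$. $\mathrm{Ind}(G_{\mathrm{inc}})$ is the family of nonempty independent sets. For $P_A>0$ and $\mathsf A_o\sim\pi_A$, $$H_{G_{\mathrm{inc}}}(\pi_A)=\min_{P_{W\mid A}} I(\mathsf A_o;W),$$ the minimum being over conditional laws of a random subset $W\subseteq A$ given $\mathsf A_o$ such that $\mathsf A_o\in W$ and $W\in\mathrm{Ind}(G_{\mathrm{inc}})$ almost surely. *)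

theory Defs
  imports "HOL-Probability.Probability"
begin

text \<open>
  The finite set of all statements is the universe of a type of class \<open>finite\<close>.  A proof system
  enters only through its consequence operator \<open>Cn\<close>; derivability is trivially decidable here,
  because there are finitely many statements.
\<close>

definition consequence_operator :: "('a set \<Rightarrow> 'a set) \<Rightarrow> bool" where
  "consequence_operator Cn \<longleftrightarrow>
     (\<forall>\<Gamma>. \<Gamma> \<subseteq> Cn \<Gamma>) \<and>
     (\<forall>\<Gamma> \<Delta>. \<Gamma> \<subseteq> \<Delta> \<longrightarrow> Cn \<Gamma> \<subseteq> Cn \<Delta>) \<and>
     (\<forall>\<Gamma>. Cn (Cn \<Gamma>) = Cn \<Gamma>)"

text \<open>
  A knowledge base with its canonical linear order is a duplicate-free list; the underlying
  set is \<open>set ss\<close>.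
\<close>

definition atom_core :: "('a set \<Rightarrow> 'a set) \<Rightarrow> 'a list \<Rightarrow> 'a set" where
  "atom_core Cn ss =
     fold (\<lambda>s B. if s \<in> Cn (B - {s}) then B - {s} else B) ss (set ss)"

text \<open>
  The case distinction is needed because division by zero yields \<open>0\<close> in HOL, which would give
  the distortion \<open>1\<close> instead of \<open>0\<close> when both closures are empty.
\<close>

definition closure_distortion :: "('a set \<Rightarrow> 'a set) \<Rightarrow> 'a set \<Rightarrow> 'a \<Rightarrow> 'a \<Rightarrow> real" where
  "closure_distortion Cn S s t =
     (let C = Cn S; C' = Cn ((S - {s}) \<union> {t})
      in if C \<union> C' = {} then 0 else 1 - real (card (C \<inter> C')) / real (card (C \<union> C')))"

definition zero_distortion_set ::
    "('a set \<Rightarrow> 'a set) \<Rightarrow> 'a set \<Rightarrow> 'a set \<Rightarrow> 'a \<Rightarrow> 'a set" where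
  "zero_distortion_set Cn S Shat s = {t \<in> Shat. closure_distortion Cn S s t = 0}"

text \<open>A channel is a kernel \<open>K\<close> into pmfs; \<open>joint_pmf p K\<close> is the joint law of input and output.\<close>

definition joint_pmf :: "'x pmf \<Rightarrow> ('x \<Rightarrow> 'y pmf) \<Rightarrow> ('x \<times> 'y) pmf" where
  "joint_pmf p K = bind_pmf p (\<lambda>x. map_pmf (Pair x) (K x))"

definition channel_mutual_information ::
    "real \<Rightarrow> 'x pmf \<Rightarrow> ('x \<Rightarrow> 'y pmf) \<Rightarrow> real" where
  "channel_mutual_information b p K =
     prob_space.mutual_information (measure_pmf (joint_pmf p K)) b
       (count_space UNIV) (count_space UNIV) fst snd"

text \<open>
  The minima below are written as infima in \<^typ>\<open>ereal\<close>.  All alphabets are finite, so the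
  infimum over a nonempty set of channels is attained by compactness; over the empty set it
  is \<open>\<infinity>\<close>.
\<close>

definition rate_distortion ::
    "real \<Rightarrow> 'x set \<Rightarrow> 'y set \<Rightarrow> ('x \<Rightarrow> 'y \<Rightarrow> real) \<Rightarrow> 'x pmf \<Rightarrow> real \<Rightarrow> ereal" where
  "rate_distortion b X Y d p D =
     (INF K \<in> {K. (\<forall>x\<in>X. set_pmf (K x) \<subseteq> Y) \<and>
                  measure_pmf.expectation (joint_pmf p K) (\<lambda>(x, y). d x y) \<le> D}.
        ereal (channel_mutual_information b p K))"

definition independent_sets :: "'v set \<Rightarrow> ('v \<times> 'v) set \<Rightarrow> 'v set set" where
  "independent_sets V E = {W. W \<noteq> {} \<and> W \<subseteq> V \<and> (\<forall>v\<in>W. \<forall>w\<in>W. (v, w) \<notin> E)}"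

definition graph_entropy :: "real \<Rightarrow> 'v set \<Rightarrow> ('v \<times> 'v) set \<Rightarrow> 'v pmf \<Rightarrow> ereal" where
  "graph_entropy b V E p =
     (INF K \<in> {K :: 'v \<Rightarrow> 'v set pmf.
                  AE (v, W) in measure_pmf (joint_pmf p K). v \<in> W \<and> W \<in> independent_sets V E}.
        ereal (channel_mutual_information b p K))"

definition incompatibility_edges ::
    "('a set \<Rightarrow> 'a set) \<Rightarrow> 'a list \<Rightarrow> 'a set \<Rightarrow> ('a \<times> 'a) set" where
  "incompatibility_edges Cn ss Shat =
     {(a, a'). a \<in> atom_core Cn ss \<and> a' \<in> atom_core Cn ss \<and> a \<noteq> a' \<and>
        zero_distortion_set Cn (set ss) Shat a \<inter> zero_distortion_set Cn (set ss) Shat a' = {}}"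

end

theory Submission
  imports Defs
begin

text \<open>
  Given a channel of zero distortion, restricting the source to the core loses at most the factor
  \<open>P_A\<close>, and replacing each output \<open>t\<close> by the set of core elements \<open>a\<close> with \<open>t \<in> R a\<close>
  gives a channel into independent sets, without increasing the information.  Conversely, pairwise
  realisability provides for each independent set one symbol reproducing all its members.  Since a
  redundant statement is reproduced by every symbol of \<open>Cn S\<close>, it can be sent, independently of
  its value, to the output marginal of the core, at no cost in rate.
\<close>

section \<open>Relative entropy on finite alphabets\<close>

text \<open>Where \<open>pmf N y = 0 < pmf M y\<close>, division by zero gives the quotient 0
  instead of an infinite value. The value is therefore used only under an inclusion of supports or
  behind a weight that vanishes.\<close>

definition pmf_divergence :: "real \<Rightarrow> 'y::finite pmf \<Rightarrow> 'y pmf \<Rightarrow> real" where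
  "pmf_divergence b M N = (\<Sum>y\<in>UNIV. pmf M y * log b (pmf M y / pmf N y))"

lemma expectation_pmf_finite:
  fixes M :: "'y::finite pmf" and g :: "'y \<Rightarrow> real"
  shows "measure_pmf.expectation M g = (\<Sum>y\<in>UNIV. pmf M y * g y)"
  by (subst integral_measure_pmf_real[where A=UNIV]) (auto simp: mult.commute)

lemma sum_pmf_map_pmf:
  fixes M :: "'y::finite pmf" and f :: "'y \<Rightarrow> 'z::finite" and g :: "'z \<Rightarrow> real"
  shows "(\<Sum>z\<in>UNIV. pmf (map_pmf f M) z * g z) = (\<Sum>y\<in>UNIV. pmf M y * g (f y))"
  by (simp flip: expectation_pmf_finite)

text \<open>Data processing: \<open>ln t \<le> t - 1\<close> is applied at each point and summed,
  and the terms in \<open>f y\<close> regroup along the fibres of \<open>f\<close>.\<close>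

lemma pmf_divergence_map_pmf_le:
  fixes M N :: "'y::finite pmf" and f :: "'y \<Rightarrow> 'z::finite"
  assumes b: "b > 1" and ac: "set_pmf M \<subseteq> set_pmf N"
  shows "pmf_divergence b (map_pmf f M) (map_pmf f N) \<le> pmf_divergence b M N"
proof -
  let ?m = "pmf M" and ?n = "pmf N"
  let ?m' = "pmf (map_pmf f M)" and ?n' = "pmf (map_pmf f N)"
  have *: "?m y - ?n y * (?m' (f y) / ?n' (f y))
      \<le> ?m y * ln (?m y / ?n y) - ?m y * ln (?m' (f y) / ?n' (f y))" for y
  proof (cases "?m y = 0")
    case False
    then have pos: "?m y > 0" "?n y > 0" "?m' (f y) > 0" "?n' (f y) > 0"
      using ac by (auto intro!: pmf_positive simp: set_pmf_iff)
    \<comment> \<open>The likelihood ratio after the map divided by the one before it, so that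
      \<open>- ln t\<close> is the difference of the two logarithms.\<close>
    define t where "t = ?n y * ?m' (f y) / (?m y * ?n' (f y))"
    have "ln t \<le> t - 1"
      using pos by (intro ln_le_minus_one) (simp add: t_def)
    then have "?m y * (1 - t) \<le> ?m y * (- ln t)"
      using pos by (intro mult_left_mono) auto
    moreover have "- ln t = ln (?m y / ?n y) - ln (?m' (f y) / ?n' (f y))"
      using pos by (simp add: t_def ln_div ln_mult)
    moreover have "?m y * (1 - t) = ?m y - ?n y * (?m' (f y) / ?n' (f y))"
      using pos by (simp add: t_def field_simps)
    ultimately show ?thesis
      by (simp add: right_diff_distrib)
  qed simp
  have "(\<Sum>y\<in>UNIV. ?n y * (?m' (f y) / ?n' (f y))) = (\<Sum>z\<in>UNIV. ?n' z * (?m' z / ?n' z))"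
    by (simp only: sum_pmf_map_pmf[where g="\<lambda>z. ?m' z / ?n' z"])
  \<comment> \<open>The terms agree where \<open>?n' z\<close> is nonzero; elsewhere the left one is
    0 and the right one is nonnegative.\<close>
  also have "\<dots> \<le> (\<Sum>z\<in>UNIV. ?m' z)"
    by (intro sum_mono) simp
  finally have "0 \<le> (\<Sum>y\<in>UNIV. ?m y - ?n y * (?m' (f y) / ?n' (f y)))"
    by (simp add: sum_subtractf sum_pmf_eq_1)
  also have "\<dots> \<le> (\<Sum>y\<in>UNIV. ?m y * ln (?m y / ?n y) - ?m y * ln (?m' (f y) / ?n' (f y)))"
    by (intro sum_mono *)
  also have "\<dots> = (\<Sum>y\<in>UNIV. ?m y * ln (?m y / ?n y)) - (\<Sum>z\<in>UNIV. ?m' z * ln (?m' z / ?n' z))"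
    by (simp only: sum_subtractf sum_pmf_map_pmf[where g="\<lambda>z. ln (?m' z / ?n' z)"])
  also have "\<dots> = ln b * (pmf_divergence b M N - pmf_divergence b (map_pmf f M) (map_pmf f N))"
    using b by (simp add: pmf_divergence_def log_def right_diff_distrib sum_distrib_left)
  finally show ?thesis
    using b by (simp add: zero_le_mult_iff)
qed

text \<open>Gibbs' inequality, as data processing for the map to a single point.\<close>

lemma pmf_divergence_nonneg:
  fixes M N :: "'y::finite pmf"
  assumes "b > 1" "set_pmf M \<subseteq> set_pmf N"
  shows "0 \<le> pmf_divergence b M N"
proof -
  have "pmf_divergence b (map_pmf (\<lambda>_. ()) M) (map_pmf (\<lambda>_. ()) N) = 0"
    by (simp add: pmf_divergence_def)
  then show ?thesis
    using pmf_divergence_map_pmf_le[OF assms, of "\<lambda>_. ()"] by simp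
qed

lemma pmf_divergence_self [simp]: "pmf_divergence b M M = 0"
  by (auto simp: pmf_divergence_def intro!: sum.neutral)

section \<open>Mutual information of a channel\<close>

lemma set_joint_pmf: "set_pmf (joint_pmf p K) = {(x, y). x \<in> set_pmf p \<and> y \<in> set_pmf (K x)}"
  by (auto simp: joint_pmf_def)

lemma map_fst_joint_pmf: "map_pmf fst (joint_pmf p K) = p"
  by (simp add: joint_pmf_def map_bind_pmf map_pmf_comp bind_return_pmf')

lemma map_snd_joint_pmf: "map_pmf snd (joint_pmf p K) = bind_pmf p K"
  by (simp add: joint_pmf_def map_bind_pmf map_pmf_comp)

lemma pmf_bind_finite:
  fixes p :: "'x::finite pmf"
  shows "pmf (bind_pmf p K) y = (\<Sum>x\<in>UNIV. pmf p x * pmf (K x) y)"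
  by (simp add: pmf_bind expectation_pmf_finite)

lemma pmf_joint_pmf:
  fixes p :: "'x::finite pmf"
  shows "pmf (joint_pmf p K) (x, y) = pmf p x * pmf (K x) y"
proof -
  have "pmf (map_pmf (Pair x') (K x')) (x, y) = (if x' = x then pmf (K x) y else 0)" for x'
    by (auto simp: pmf_map_inj' inj_on_def pmf_eq_0_set_pmf)
  then have "pmf (joint_pmf p K) (x, y) =
      (\<Sum>x'\<in>UNIV. if x' = x then pmf p x * pmf (K x) y else 0)"
    unfolding joint_pmf_def pmf_bind_finite by (intro sum.cong) auto
  then show ?thesis
    by simp
qed

lemma simple_distributed_measure_pmf:
  fixes M :: "'c::finite pmf"
  shows "simple_distributed (measure_pmf M) X (pmf (map_pmf X M))"
  by (rule prob_space.simple_distributedI)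
    (auto simp: measure_pmf.prob_space_axioms simple_function_def pmf_map vimage_def)

text \<open>The factor \<open>pmf p x\<close> of the joint law cancels inside the logarithm. This
  form lets information be compared input by input.\<close>

lemma channel_mutual_information_eq:
  fixes p :: "'x::finite pmf" and K :: "'x \<Rightarrow> 'y::finite pmf"
  assumes b: "b > 1"
  shows "channel_mutual_information b p K =
    (\<Sum>x\<in>UNIV. pmf p x * pmf_divergence b (K x) (bind_pmf p K))"
proof -
  let ?J = "joint_pmf p K"
  interpret information_space "measure_pmf ?J" b
    by unfold_locales (rule b)
  note sd = simple_distributed_measure_pmf[of ?J]
  have "channel_mutual_information b p K =
      (\<Sum>(x, y)\<in>UNIV. pmf ?J (x, y) * log b (pmf ?J (x, y) / (pmf p x * pmf (bind_pmf p K) y)))"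
    using mutual_information_simple_distributed[OF sd[of fst] sd[of snd] sd]
    by (simp add: channel_mutual_information_def map_fst_joint_pmf map_snd_joint_pmf)
  also have "\<dots> = (\<Sum>x\<in>UNIV. \<Sum>y\<in>UNIV.
      pmf ?J (x, y) * log b (pmf ?J (x, y) / (pmf p x * pmf (bind_pmf p K) y)))"
    by (simp add: sum.cartesian_product)
  also have "\<dots> = (\<Sum>x\<in>UNIV. pmf p x * pmf_divergence b (K x) (bind_pmf p K))"
    by (auto simp: pmf_divergence_def sum_distrib_left pmf_joint_pmf mult.assoc intro!: sum.cong)
  finally show ?thesis .
qed

lemma set_pmf_kernel_subset:
  assumes "pmf p x \<noteq> 0"
  shows "set_pmf (K x) \<subseteq> set_pmf (bind_pmf p K)"
  using assms by (auto simp: pmf_eq_0_set_pmf)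

text \<open>The row of an input of mass zero may leave the support of the marginal; the weight
  removes exactly this case.\<close>

lemma weighted_divergence_to_marginal_nonneg:
  fixes K :: "'x \<Rightarrow> 'y::finite pmf"
  assumes "b > 1"
  shows "0 \<le> pmf p x * pmf_divergence b (K x) (bind_pmf p K)"
  using pmf_divergence_nonneg[OF assms set_pmf_kernel_subset[of p x K]]
  by (cases "pmf p x = 0") simp_all

lemma channel_mutual_information_nonneg:
  fixes p :: "'x::finite pmf" and K :: "'x \<Rightarrow> 'y::finite pmf"
  assumes "b > 1"
  shows "0 \<le> channel_mutual_information b p K"
  using assms
  by (simp add: channel_mutual_information_eq sum_nonneg weighted_divergence_to_marginal_nonneg)

text \<open>The compensation identity: each logarithm splits through the output marginal, and the
  second part averages to the divergence of the marginal from \<open>r\<close>.\<close>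

lemma expected_divergence_eq:
  fixes p :: "'x::finite pmf" and K :: "'x \<Rightarrow> 'y::finite pmf"
  assumes b: "b > 1" and ac: "\<And>x. x \<in> set_pmf p \<Longrightarrow> set_pmf (K x) \<subseteq> set_pmf r"
  shows "(\<Sum>x\<in>UNIV. pmf p x * pmf_divergence b (K x) r) =
    channel_mutual_information b p K + pmf_divergence b (bind_pmf p K) r"
proof -
  let ?q = "bind_pmf p K"
  have *: "pmf p x * (pmf (K x) y * log b (pmf (K x) y / pmf r y)) =
      pmf p x * (pmf (K x) y * log b (pmf (K x) y / pmf ?q y)) +
      pmf p x * (pmf (K x) y * log b (pmf ?q y / pmf r y))" for x y
  proof (cases "x \<in> set_pmf p \<and> y \<in> set_pmf (K x)")
    case True
    then have "y \<in> set_pmf r" "y \<in> set_pmf ?q"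
      using ac by auto
    with True have "pmf (K x) y > 0" "pmf r y > 0" "pmf ?q y > 0"
      by (simp_all add: pmf_positive del: set_bind_pmf)
    then have "log b (pmf (K x) y / pmf r y) =
        log b (pmf (K x) y / pmf ?q y) + log b (pmf ?q y / pmf r y)"
      by (simp add: log_def ln_div diff_divide_distrib)
    then show ?thesis
      by (simp add: algebra_simps)
  qed (auto simp: set_pmf_iff)
  have "(\<Sum>x\<in>UNIV. pmf p x * pmf_divergence b (K x) r) =
      channel_mutual_information b p K +
      (\<Sum>x\<in>UNIV. \<Sum>y\<in>UNIV. pmf p x * (pmf (K x) y * log b (pmf ?q y / pmf r y)))"
    by (simp add: channel_mutual_information_eq[OF b] pmf_divergence_def sum_distrib_left
        * sum.distrib)
  also have "(\<Sum>x\<in>UNIV. \<Sum>y\<in>UNIV. pmf p x * (pmf (K x) y * log b (pmf ?q y / pmf r y))) =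
      pmf_divergence b ?q r"
    by (subst sum.swap)
      (simp add: pmf_divergence_def pmf_bind_finite[of p K] sum_distrib_right mult.assoc)
  finally show ?thesis .
qed

text \<open>Processing the output maps the rows and their marginal by the same \<open>f\<close>, so
  data processing for divergences applies to each input.\<close>

lemma channel_mutual_information_map_pmf_le:
  fixes p :: "'x::finite pmf" and K :: "'x \<Rightarrow> 'y::finite pmf" and f :: "'y \<Rightarrow> 'z::finite"
  assumes b: "b > 1"
  shows "channel_mutual_information b p (\<lambda>x. map_pmf f (K x)) \<le> channel_mutual_information b p K"
proof -
  have "pmf p x * pmf_divergence b (map_pmf f (K x)) (map_pmf f (bind_pmf p K))
      \<le> pmf p x * pmf_divergence b (K x) (bind_pmf p K)" for x
    using pmf_divergence_map_pmf_le[OF b set_pmf_kernel_subset[of p x K], of f]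
    by (cases "pmf p x = 0") (simp_all add: mult_left_mono)
  then show ?thesis
    by (simp add: channel_mutual_information_eq[OF b] map_bind_pmf[symmetric] sum_mono)
qed

section \<open>Conditioning the source on an event and extending a channel beyond it\<close>

lemma sum_pmf_cond_pmf:
  fixes p :: "'x::finite pmf"
  assumes "set_pmf p \<inter> A \<noteq> {}"
  shows "measure_pmf.prob p A * (\<Sum>x\<in>UNIV. pmf (cond_pmf p A) x * g x) = (\<Sum>x\<in>A. pmf p x * g x)"
proof -
  have "measure_pmf.prob p A \<noteq> 0"
    using assms by (rule measure_measure_pmf_not_zero)
  then have "measure_pmf.prob p A * (pmf (cond_pmf p A) x * g x) =
      (if x \<in> A then pmf p x * g x else 0)" for x
    using assms by (simp add: pmf_cond)
  then show ?thesis
    by (simp add: sum_distrib_left sum.If_cases)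
qed

lemma channel_mutual_information_cond_pmf_le:
  fixes p :: "'x::finite pmf" and K :: "'x \<Rightarrow> 'y::finite pmf"
  assumes b: "b > 1" and A: "set_pmf p \<inter> A \<noteq> {}"
  shows "measure_pmf.prob p A * channel_mutual_information b (cond_pmf p A) K
    \<le> channel_mutual_information b p K"
proof -
  let ?q = "bind_pmf p K" and ?D = "\<lambda>x. pmf_divergence b (K x) (bind_pmf p K)"
  \<comment> \<open>The rows are compared with the marginal of the whole source, which cannot lower
    their mean divergence. After scaling, this mean is the part over \<open>A\<close> of the sum for
    the whole source.\<close>
  have "channel_mutual_information b (cond_pmf p A) K \<le>
      channel_mutual_information b (cond_pmf p A) K +
      pmf_divergence b (bind_pmf (cond_pmf p A) K) ?q"
    using pmf_divergence_nonneg[OF b, of "bind_pmf (cond_pmf p A) K" ?q] A by auto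
  also have "\<dots> = (\<Sum>x\<in>UNIV. pmf (cond_pmf p A) x * ?D x)"
    using A by (intro expected_divergence_eq[OF b, symmetric]) auto
  finally have "measure_pmf.prob p A * channel_mutual_information b (cond_pmf p A) K
      \<le> (\<Sum>x\<in>A. pmf p x * ?D x)"
    by (simp add: sum_pmf_cond_pmf[OF A, symmetric] mult_left_mono)
  also have "\<dots> \<le> (\<Sum>x\<in>UNIV. pmf p x * ?D x)"
    by (intro sum_mono2) (simp_all add: weighted_divergence_to_marginal_nonneg[OF b])
  finally show ?thesis
    by (simp add: channel_mutual_information_eq[OF b])
qed

text \<open>The output law is a mixture of the law given \<open>A\<close> and the law given its
  complement, and both equal the marginal of the conditioned source.\<close>

lemma bind_pmf_extend_by_marginal:
  fixes p :: "'x::finite pmf" and K :: "'x \<Rightarrow> 'y::finite pmf"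
  assumes A: "set_pmf p \<inter> A \<noteq> {}"
    and in_A: "\<And>x. x \<in> set_pmf p \<inter> A \<Longrightarrow> K x = L x"
    and out_A: "\<And>x. x \<in> set_pmf p - A \<Longrightarrow> K x = bind_pmf (cond_pmf p A) L"
  shows "bind_pmf p K = bind_pmf (cond_pmf p A) L"
proof (rule pmf_eqI)
  fix y
  let ?q = "pmf (bind_pmf (cond_pmf p A) L) y"
  have q: "measure_pmf.prob p A * ?q = (\<Sum>x\<in>A. pmf p x * pmf (L x) y)"
    by (simp add: pmf_bind_finite sum_pmf_cond_pmf[OF A])
  have "pmf (bind_pmf p K) y =
      (\<Sum>x\<in>A. pmf p x * pmf (K x) y) + (\<Sum>x\<in>-A. pmf p x * pmf (K x) y)"
    by (simp add: pmf_bind_finite Compl_eq_Diff_UNIV sum.subset_diff[of A UNIV])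
  also have "(\<Sum>x\<in>A. pmf p x * pmf (K x) y) = (\<Sum>x\<in>A. pmf p x * pmf (L x) y)"
  proof (intro sum.cong refl)
    show "pmf p x * pmf (K x) y = pmf p x * pmf (L x) y" if "x \<in> A" for x
      using in_A[of x] that by (cases "pmf p x = 0") (simp_all add: set_pmf_iff)
  qed
  also have "(\<Sum>x\<in>-A. pmf p x * pmf (K x) y) = (\<Sum>x\<in>-A. pmf p x * ?q)"
  proof (intro sum.cong refl)
    show "pmf p x * pmf (K x) y = pmf p x * ?q" if "x \<in> -A" for x
      using out_A[of x] that by (cases "pmf p x = 0") (simp_all add: set_pmf_iff)
  qed
  also have "(\<Sum>x\<in>A. pmf p x * pmf (L x) y) + (\<Sum>x\<in>-A. pmf p x * ?q) =
      (\<Sum>x\<in>UNIV. pmf p x) * ?q"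
    by (simp add: q[symmetric] measure_measure_pmf_finite flip: sum_distrib_right distrib_right)
      (simp add: Compl_eq_Diff_UNIV sum.subset_diff[of A UNIV] add.commute)
  finally show "pmf (bind_pmf p K) y = ?q"
    by (simp add: sum_pmf_eq_1)
qed

text \<open>
  Inputs outside \<open>A\<close> that are sent to the output marginal of the inputs in \<open>A\<close> leave this
  marginal unchanged, so they contribute no information.
\<close>

lemma channel_mutual_information_extend_by_marginal:
  fixes p :: "'x::finite pmf" and K :: "'x \<Rightarrow> 'y::finite pmf"
  assumes b: "b > 1" and A: "set_pmf p \<inter> A \<noteq> {}"
    and in_A: "\<And>x. x \<in> set_pmf p \<inter> A \<Longrightarrow> K x = L x"
    and out_A: "\<And>x. x \<in> set_pmf p - A \<Longrightarrow> K x = bind_pmf (cond_pmf p A) L"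
  shows "channel_mutual_information b p K =
    measure_pmf.prob p A * channel_mutual_information b (cond_pmf p A) L"
proof -
  let ?q = "bind_pmf (cond_pmf p A) L"
  have "bind_pmf p K = ?q"
    using A in_A out_A by (rule bind_pmf_extend_by_marginal)
  then have "channel_mutual_information b p K = (\<Sum>x\<in>UNIV. pmf p x * pmf_divergence b (K x) ?q)"
    by (simp add: channel_mutual_information_eq[OF b])
  also have "\<dots> = (\<Sum>x\<in>A. pmf p x * pmf_divergence b (L x) ?q)"
  proof (rule sum.mono_neutral_cong_right)
    show "\<forall>x\<in>UNIV - A. pmf p x * pmf_divergence b (K x) ?q = 0"
    proof
      show "pmf p x * pmf_divergence b (K x) ?q = 0" if "x \<in> UNIV - A" for x
        using out_A[of x] that by (cases "pmf p x = 0") (simp_all add: set_pmf_iff)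
    qed
    show "pmf p x * pmf_divergence b (K x) ?q = pmf p x * pmf_divergence b (L x) ?q"
      if "x \<in> A" for x
      using in_A[of x] that by (cases "pmf p x = 0") (simp_all add: set_pmf_iff)
  qed auto
  finally show ?thesis
    by (simp add: channel_mutual_information_eq[OF b] sum_pmf_cond_pmf[OF A])
qed

lemma channel_mutual_information_const:
  fixes p :: "'x::finite pmf" and q :: "'y::finite pmf"
  assumes "b > 1"
  shows "channel_mutual_information b p (\<lambda>_. q) = 0"
  by (simp add: channel_mutual_information_eq[OF assms])

section \<open>The core and zero closure distortion\<close>

lemma consequence_operator_extensive: "consequence_operator Cn \<Longrightarrow> \<Gamma> \<subseteq> Cn \<Gamma>"
  by (simp add: consequence_operator_def)

lemma consequence_operator_mono: "consequence_operator Cn \<Longrightarrow> \<Gamma> \<subseteq> \<Delta> \<Longrightarrow> Cn \<Gamma> \<subseteq> Cn \<Delta>"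
  by (simp add: consequence_operator_def)

text \<open>Monotonicity yields \<open>Cn (Cn \<Delta>)\<close> as a bound, which idempotence
  collapses.\<close>

lemma consequence_operator_least:
  assumes "consequence_operator Cn" "\<Gamma> \<subseteq> Cn \<Delta>"
  shows "Cn \<Gamma> \<subseteq> Cn \<Delta>"
  using assms consequence_operator_mono[OF assms] by (simp add: consequence_operator_def)

lemma atom_core_subset_and_closure:
  assumes Cn: "consequence_operator Cn"
  shows "atom_core Cn ss \<subseteq> set ss \<and> Cn (atom_core Cn ss) = Cn (set ss)"
proof -
  \<comment> \<open>The start value is arbitrary because the scan changes the current base. A
    deleted statement is derivable from the rest, so no deletion changes the closure.\<close>
  have "fold (\<lambda>s B. if s \<in> Cn (B - {s}) then B - {s} else B) xs B \<subseteq> B \<and>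
      Cn (fold (\<lambda>s B. if s \<in> Cn (B - {s}) then B - {s} else B) xs B) = Cn B" for xs B
  proof (induction xs arbitrary: B)
    case (Cons s xs)
    have "Cn (B - {s}) = Cn B" if "s \<in> Cn (B - {s})"
    proof
      show "Cn (B - {s}) \<subseteq> Cn B"
        using Cn by (rule consequence_operator_mono) blast
      have "B \<subseteq> Cn (B - {s})"
        using consequence_operator_extensive[OF Cn, of "B - {s}"] that by blast
      then show "Cn B \<subseteq> Cn (B - {s})"
        by (rule consequence_operator_least[OF Cn])
    qed
    then show ?case
      using Cons.IH[of B] Cons.IH[of "B - {s}"] by auto
  qed simp
  then show ?thesis
    unfolding atom_core_def .
qed

section \<open>Symbols of zero closure distortion\<close>

lemma closure_distortion_nonneg:
  fixes Cn :: "'a::finite set \<Rightarrow> 'a set"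
  shows "0 \<le> closure_distortion Cn S s t"
  by (auto simp: closure_distortion_def Let_def divide_le_eq intro!: card_mono)

text \<open>The Jaccard distance of two finite sets vanishes only if intersection and union have
  equal size, hence coincide; two empty closures fall under the convention for 0/0.\<close>

lemma closure_distortion_eq_0_iff:
  fixes Cn :: "'a::finite set \<Rightarrow> 'a set"
  shows "closure_distortion Cn S s t = 0 \<longleftrightarrow> Cn ((S - {s}) \<union> {t}) = Cn S"
proof (cases "Cn S \<union> Cn ((S - {s}) \<union> {t}) = {}")
  case False
  let ?C = "Cn S" and ?C' = "Cn ((S - {s}) \<union> {t})"
  have "card (?C \<union> ?C') \<noteq> 0"
    using False by simp
  then have "closure_distortion Cn S s t = 0 \<longleftrightarrow> card (?C \<inter> ?C') = card (?C \<union> ?C')"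
    using False by (auto simp: closure_distortion_def Let_def)
  also have "\<dots> \<longleftrightarrow> ?C \<inter> ?C' = ?C \<union> ?C'"
    using card_subset_eq[of "?C \<union> ?C'" "?C \<inter> ?C'"] by (metis finite le_infI1 sup_ge1)
  also have "\<dots> \<longleftrightarrow> ?C' = ?C"
    by blast
  finally show ?thesis .
qed (auto simp: closure_distortion_def)

lemma zero_distortion_set_subset:
  fixes Cn :: "'a::finite set \<Rightarrow> 'a set"
  assumes Cn: "consequence_operator Cn"
  shows "zero_distortion_set Cn S Shat s \<subseteq> Shat \<inter> Cn S"
proof
  fix t
  assume "t \<in> zero_distortion_set Cn S Shat s"
  then have "t \<in> Shat" "Cn ((S - {s}) \<union> {t}) = Cn S"
    by (simp_all add: zero_distortion_set_def closure_distortion_eq_0_iff)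
  then show "t \<in> Shat \<inter> Cn S"
    using consequence_operator_extensive[OF Cn, of "(S - {s}) \<union> {t}"] by auto
qed

text \<open>Removing \<open>s\<close> leaves the whole core, which already generates
  \<open>Cn (set ss)\<close>, and adding a consequence creates nothing new. All redundant statements
  thus share the same admissible symbols.\<close>

lemma zero_distortion_set_outside_core:
  fixes Cn :: "'a::finite set \<Rightarrow> 'a set"
  assumes Cn: "consequence_operator Cn" and s: "s \<notin> atom_core Cn ss"
  shows "zero_distortion_set Cn (set ss) Shat s = Shat \<inter> Cn (set ss)"
proof
  let ?S = "set ss" and ?A = "atom_core Cn ss"
  show "Shat \<inter> Cn ?S \<subseteq> zero_distortion_set Cn ?S Shat s"
  proof
    fix t
    assume t: "t \<in> Shat \<inter> Cn ?S"
    have "Cn ((?S - {s}) \<union> {t}) \<subseteq> Cn ?S"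
      using consequence_operator_extensive[OF Cn, of ?S] t
      by (intro consequence_operator_least[OF Cn]) auto
    moreover have "Cn ?A \<subseteq> Cn ((?S - {s}) \<union> {t})"
      using atom_core_subset_and_closure[OF Cn, of ss] s
      by (intro consequence_operator_mono[OF Cn]) auto
    ultimately show "t \<in> zero_distortion_set Cn ?S Shat s"
      using t atom_core_subset_and_closure[OF Cn, of ss]
      by (auto simp: zero_distortion_set_def closure_distortion_eq_0_iff)
  qed
qed (rule zero_distortion_set_subset[OF Cn])

text \<open>A nonnegative function with integral zero vanishes almost everywhere, which turns the
  distortion constraint into a condition on supports.\<close>

lemma expected_distortion_le_0_iff:
  fixes d :: "'x::finite \<Rightarrow> 'y::finite \<Rightarrow> real"
  assumes "\<And>x y. 0 \<le> d x y"
  shows "measure_pmf.expectation (joint_pmf p K) (\<lambda>(x, y). d x y) \<le> 0 \<longleftrightarrow>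
    (\<forall>x\<in>set_pmf p. \<forall>y\<in>set_pmf (K x). d x y = 0)"
proof -
  let ?J = "joint_pmf p K"
  have nonneg: "\<And>z. 0 \<le> (case z of (x, y) \<Rightarrow> d x y)"
    using assms by auto
  have "0 \<le> measure_pmf.expectation ?J (\<lambda>(x, y). d x y)"
    by (rule integral_nonneg_AE) (simp add: nonneg)
  then have "measure_pmf.expectation ?J (\<lambda>(x, y). d x y) \<le> 0 \<longleftrightarrow>
      measure_pmf.expectation ?J (\<lambda>(x, y). d x y) = 0"
    by linarith
  also have "\<dots> \<longleftrightarrow> (AE z in ?J. (case z of (x, y) \<Rightarrow> d x y) = 0)"
    by (rule integral_nonneg_eq_0_iff_AE)
      (simp_all add: nonneg integrable_measure_pmf_finite)
  also have "\<dots> \<longleftrightarrow> (\<forall>x\<in>set_pmf p. \<forall>y\<in>set_pmf (K x). d x y = 0)"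
    by (auto simp: AE_measure_pmf_iff set_joint_pmf)
  finally show ?thesis .
qed

section \<open>The zero-distortion rate\<close>

text \<open>The base \<open>b\<close> fixes the unit of information on both sides. The case
  \<open>P_A = 0\<close> is separate because there is then no law to condition on the core.\<close>

theorem mainTheorem3:
  fixes b :: real
    and Cn :: "'a::finite set \<Rightarrow> 'a set"
    and ss :: "'a list"
    and Shat :: "'a set"
    and P :: "'a pmf"
  defines "S \<equiv> set ss"
    and "A \<equiv> atom_core Cn ss"
    and "R \<equiv> zero_distortion_set Cn (set ss) Shat"
    and "P_A \<equiv> measure_pmf.prob P (atom_core Cn ss)"
  assumes base: "b > 1"
    and Cn: "consequence_operator Cn"
    and order: "distinct ss"
    and alphabet: "Shat \<noteq> {}"
    and source: "set_pmf P \<subseteq> S"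
    and core_nonempty: "A \<noteq> {}"
    and feasible: "(P_A = 0 \<and> Shat \<inter> Cn S \<noteq> {}) \<or> (P_A > 0 \<and> (\<forall>a\<in>A. R a \<noteq> {}))"
    and pairwise_realisable:
      "\<And>W. W \<subseteq> A \<Longrightarrow> W \<noteq> {} \<Longrightarrow> (\<forall>a\<in>W. \<forall>a'\<in>W. a \<noteq> a' \<longrightarrow> R a \<inter> R a' \<noteq> {}) \<Longrightarrow>
         (\<Inter>a\<in>W. R a) \<noteq> {}"
  shows "rate_distortion b S Shat (closure_distortion Cn S) P 0 =
    (if P_A = 0 then 0
     else ereal P_A * graph_entropy b A (incompatibility_edges Cn ss Shat) (cond_pmf P A))"
proof -
  let ?I = "channel_mutual_information b" and ?E = "incompatibility_edges Cn ss Shat"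
  define feas where "feas = {K. (\<forall>x\<in>S. set_pmf (K x) \<subseteq> Shat) \<and>
    measure_pmf.expectation (joint_pmf P K) (\<lambda>(x, y). closure_distortion Cn S x y) \<le> 0}"
  have rd: "rate_distortion b S Shat (closure_distortion Cn S) P 0 = (INF K\<in>feas. ereal (?I P K))"
    by (simp add: rate_distortion_def feas_def)
  \<comment> \<open>Zero distortion constrains only inputs of positive mass, whereas the alphabet
    constrains every input in \<open>S\<close>.\<close>
  have feas_iff: "K \<in> feas \<longleftrightarrow> (\<forall>x\<in>S. set_pmf (K x) \<subseteq> Shat) \<and> (\<forall>x\<in>set_pmf P. set_pmf (K x) \<subseteq> R x)"
    for K
    using source
    by (auto simp: feas_def expected_distortion_le_0_iff[OF closure_distortion_nonneg]
        R_def zero_distortion_set_def S_def subset_iff)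
  have R_sub: "R x \<subseteq> Shat \<inter> Cn S" for x
    unfolding R_def S_def by (rule zero_distortion_set_subset[OF Cn])
  have R_out: "R x = Shat \<inter> Cn S" if "x \<notin> A" for x
    using that unfolding R_def S_def A_def by (rule zero_distortion_set_outside_core[OF Cn])
  have P_A: "P_A = measure_pmf.prob P A"
    by (simp add: P_A_def A_def)
  show ?thesis
  proof (cases "P_A = 0")
    case True
    then obtain t where t: "t \<in> Shat \<inter> Cn S"
      using feasible by auto
    have "set_pmf P \<inter> A = {}"
      using True measure_measure_pmf_not_zero[of P A] by (auto simp: P_A)
    \<comment> \<open>Only redundant statements have mass, so one constant symbol reproduces them
      all.\<close>
    then have "(\<lambda>_. return_pmf t) \<in> feas"
      using t R_out by (auto simp: feas_iff)
    then have "(INF K\<in>feas. ereal (?I P K)) \<le> ereal (?I P (\<lambda>_. return_pmf t))"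
      by (rule INF_lower)
    moreover have "0 \<le> (INF K\<in>feas. ereal (?I P K))"
      by (rule INF_greatest) (simp add: channel_mutual_information_nonneg[OF base])
    ultimately show ?thesis
      using True by (simp add: rd channel_mutual_information_const[OF base] zero_ereal_def antisym)
  next
    case False
    then have pos: "P_A > 0"
      using feasible by auto
    have PA: "set_pmf P \<inter> A \<noteq> {}"
      using False by (auto simp: P_A measure_pmf_zero_iff)
    define \<pi> where "\<pi> = cond_pmf P A"
    have set_\<pi>: "set_pmf \<pi> = set_pmf P \<inter> A"
      by (simp add: \<pi>_def PA)
    define indep where "indep = {K :: 'a \<Rightarrow> 'a set pmf.
      AE (v, W) in measure_pmf (joint_pmf \<pi> K). v \<in> W \<and> W \<in> independent_sets A ?E}"
    have ge: "graph_entropy b A ?E \<pi> = (INF K\<in>indep. ereal (?I \<pi> K))"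
      by (simp add: graph_entropy_def indep_def)
    have indep_iff: "K \<in> indep \<longleftrightarrow>
        (\<forall>a\<in>set_pmf P \<inter> A. \<forall>W\<in>set_pmf (K a). a \<in> W \<and> W \<in> independent_sets A ?E)" for K
      by (auto simp: indep_def AE_measure_pmf_iff set_joint_pmf set_\<pi>)
    have E_iff: "(a, a') \<in> ?E \<longleftrightarrow> a \<in> A \<and> a' \<in> A \<and> a \<noteq> a' \<and> R a \<inter> R a' = {}" for a a'
      by (simp add: incompatibility_edges_def A_def R_def)
    \<comment> \<open>Independence is put into the form of the premise of
      \<open>pairwise_realisable\<close>.\<close>
    have independent_iff: "W \<in> independent_sets A ?E \<longleftrightarrow> W \<noteq> {} \<and> W \<subseteq> A \<and>
        (\<forall>a\<in>W. \<forall>a'\<in>W. a \<noteq> a' \<longrightarrow> R a \<inter> R a' \<noteq> {})" for W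
      unfolding independent_sets_def mem_Collect_eq E_iff by (metis subsetD)
    have "ereal P_A * graph_entropy b A ?E \<pi> \<le> ereal (?I P K)" if K: "K \<in> feas" for K
    proof -
      \<comment> \<open>The core elements that \<open>t\<close> reproduces. Any two of them share
        the symbol \<open>t\<close>, so they are not adjacent.\<close>
      define w where "w = (\<lambda>t. {a \<in> A. t \<in> R a})"
      have "(\<lambda>a. map_pmf w (K a)) \<in> indep"
        unfolding indep_iff
      proof (intro ballI)
        fix a W
        assume a: "a \<in> set_pmf P \<inter> A" and "W \<in> set_pmf (map_pmf w (K a))"
        then obtain t where t: "t \<in> set_pmf (K a)" "W = w t"
          by auto
        then have "t \<in> R a"
          using K a unfolding feas_iff by blast
        then have "a \<in> W"
          using a t by (simp add: w_def)
        moreover have "t \<in> R a' \<inter> R a''" if "a' \<in> W" "a'' \<in> W" for a' a''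
          using that t by (simp add: w_def)
        ultimately show "a \<in> W \<and> W \<in> independent_sets A ?E"
          using t unfolding independent_iff by (fastforce simp: w_def)
      qed
      then have "graph_entropy b A ?E \<pi> \<le> ereal (?I \<pi> (\<lambda>a. map_pmf w (K a)))"
        unfolding ge by (rule INF_lower)
      also have "\<dots> \<le> ereal (?I \<pi> K)"
        by (simp add: channel_mutual_information_map_pmf_le[OF base])
      finally have "ereal P_A * graph_entropy b A ?E \<pi> \<le> ereal P_A * ereal (?I \<pi> K)"
        using pos by (intro ereal_mult_left_mono) auto
      also have "\<dots> \<le> ereal (?I P K)"
        using channel_mutual_information_cond_pmf_le[OF base PA, of K] by (simp add: P_A \<pi>_def)
      finally show ?thesis .
    qed
    then have lower: "ereal P_A * graph_entropy b A ?E \<pi> \<le> (INF K\<in>feas. ereal (?I P K))"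
      by (rule INF_greatest)
    have "(INF K\<in>feas. ereal (?I P K)) \<le> ereal P_A * ereal (?I \<pi> K)" if K: "K \<in> indep" for K
    proof -
      \<comment> \<open>A common symbol for all members of \<open>W\<close>; it exists for
        independent \<open>W\<close> by pairwise realisability, and other \<open>W\<close> get an
        arbitrary value.\<close>
      define f where "f = (\<lambda>W. SOME t. t \<in> (\<Inter>a\<in>W. R a))"
      have f: "f W \<in> R a" if "W \<in> independent_sets A ?E" "a \<in> W" for W a
      proof -
        have "(\<Inter>a\<in>W. R a) \<noteq> {}"
          using that by (intro pairwise_realisable) (auto simp: independent_iff)
        then have "f W \<in> (\<Inter>a\<in>W. R a)"
          unfolding f_def by (metis all_not_in_conv someI_ex)
        then show ?thesis
          using that by blast
      qed
      define L where "L = (\<lambda>a. map_pmf f (K a))"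
      define q where "q = bind_pmf \<pi> L"
      \<comment> \<open>Core elements of mass zero also go to \<open>q\<close>: \<open>K\<close>,
        and hence \<open>L\<close>, is unconstrained there and could leave \<open>Shat\<close>,
        while \<open>q\<close> stays inside \<open>Shat \<inter> Cn S\<close>.\<close>
      define K' where "K' = (\<lambda>x. if x \<in> set_pmf P \<inter> A then L x else q)"
      have L: "set_pmf (L a) \<subseteq> R a" if a: "a \<in> set_pmf P \<inter> A" for a
      proof
        fix t
        assume "t \<in> set_pmf (L a)"
        then obtain W where W: "W \<in> set_pmf (K a)" "t = f W"
          by (auto simp: L_def)
        then have "a \<in> W" "W \<in> independent_sets A ?E"
          using K a unfolding indep_iff by blast+
        then show "t \<in> R a"
          using f W by simp
      qed
      have "set_pmf q = (\<Union>a\<in>set_pmf P \<inter> A. set_pmf (L a))"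
        by (simp add: q_def set_\<pi>)
      also have "\<dots> \<subseteq> Shat \<inter> Cn S"
        using L R_sub by (intro UN_least) (rule subset_trans)
      finally have q: "set_pmf q \<subseteq> Shat \<inter> Cn S" .
      have "set_pmf (K' x) \<subseteq> Shat" for x
        using L[of x] q R_sub[of x] by (simp add: K'_def) blast
      moreover have "set_pmf (K' x) \<subseteq> R x" if "x \<in> set_pmf P" for x
        using L[of x] q R_out[of x] that by (cases "x \<in> A") (simp_all add: K'_def)
      ultimately have "K' \<in> feas"
        by (simp add: feas_iff)
      then have "(INF K\<in>feas. ereal (?I P K)) \<le> ereal (?I P K')"
        by (rule INF_lower)
      also have "?I P K' = P_A * ?I \<pi> L"
        unfolding P_A \<pi>_def
        by (rule channel_mutual_information_extend_by_marginal[OF base PA])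
          (auto simp: K'_def q_def \<pi>_def)
      also have "\<dots> \<le> P_A * ?I \<pi> K"
        using pos unfolding L_def
        by (intro mult_left_mono channel_mutual_information_map_pmf_le[OF base]) auto
      finally show ?thesis
        by simp
    qed
    \<comment> \<open>Dividing by \<open>P_A\<close> leaves the graph entropy alone on the right, so
      the bound for each channel passes to the infimum; the factor is then restored.\<close>
    then have "(INF K\<in>feas. ereal (?I P K)) / ereal P_A \<le> graph_entropy b A ?E \<pi>"
      unfolding ge using pos by (intro INF_greatest) (simp add: ereal_divide_le_pos)
    then have "(INF K\<in>feas. ereal (?I P K)) \<le> ereal P_A * graph_entropy b A ?E \<pi>"
      using pos by (simp add: ereal_divide_le_pos)
    with lower show ?thesis
      using False by (simp add: rd \<pi>_def antisym)
  qed
qed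

end
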